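(* Let $L\ge 1$ and $N_c\ge 1$ be integers and consider the uplink of the locally connected network with connectivity parameter $L$ described in the context, with cell association constraint $|\mathcal C_i|\le N_c$ for all $i$, restricted to zero-forcing message passing decoding schemes. Then the zero-forcing uplink per user degrees of freedom satisfy \[ \tau_U^{\mathrm{zf}}(L,N_c)=\begin{cases}1, & L+1\le N_c,\\[2pt] \dfrac{N_c+1}{L+2}, & \dfrac{L}{2}\le N_c\le L,\\[6pt] \dfrac{2N_c}{2N_c+L}, & 1\le N_c<\dfrac{L}{2}.\end{cases} \]
   Context: Network: $K$ base stations BS $1,\dots,K$ and $K$ mobile terminals MT $1,\dots,K$, each with a single antenna. For the connectivity parameter $L$, the channel coefficient $H_{i,j}$ between MT $i$ and BS $j$ is zero if and only if $i\notin\{j,j+1,\dots,j+L\}$; the nonzero coefficients are drawn from a continuous joint distribution (results hold for almost all realizations) and global channel state information is available everywhere. In the uplink, BS $j$ receives $Y_j=\sum_{i}H_{i,j}X_i+Z_j$, where $X_i$ is the signal of MT $i$ (average power constraint $P$) and $Z_j$ is unit-variance Gaussian noise. MT $i$ has message $W_i$. A cell association assigns to each MT $i$ a set $\mathcal C_i\subseteq[K]$ of base stations with $|\mathcal C_i|\le N_c$. Only whole (decoded) messages can be exchanged over the backhaul: a message $W_i$ may be decoded at one base station in $\mathcal C_i$ and passed to the other base stations in $\mathcal C_i$, which may use it to cancel its interference. Zero-forcing (message passing decoding) uplink scheme: each active MT uses a point-to-point Gaussian code of power $P$ and each active message gets one degree of freedom; BS $i$ is active if there is $j$ with $i\in\mathcal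 C_j$ such that, given the messages $B_i$ that BS $i$ has received over the backhaul (messages decoded elsewhere and associated with BS $i$), the noiseless received signal $Y_i-Z_i$ depends on $W_j$ and on no other message (i.e. all other interference is cancelled using $B_i$); then $W_j$ is decoded at BS $i$ and (MT $j$, BS $i$) is called a decoding pair. Each message is decoded at at most one base station. Degrees of freedom: $d_i=\lim_{P\to\infty}R_i(P)/\log P$, the sum DoF $\eta$ is the maximum of $\sum_i d_i$, and $\tau_U^{\mathrm{zf}}(L,N_c)=\lim_{K\to\infty}\eta_U^{\mathrm{zf}}(K,L,N_c)/K$, where $\eta_U^{\mathrm{zf}}(K,L,N_c)$ is the maximum uplink sum DoF over all cell associations satisfying the constraint and all zero-forcing message passing decoding schemes. *)

theory Defs
  imports Complex_Main
begin

text \<open>Indices: mobile terminals and base stations are numbered 1..K.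
  MT i is connected to BS j (nonzero channel coefficient H_{i,j}) iff j \<le> i \<le> j + L.
  For almost all channel realizations, the noiseless received signal at BS j
  depends on the message of an active MT i iff MT i is connected to BS j.\<close>

definition conn :: "nat \<Rightarrow> nat \<Rightarrow> nat \<Rightarrow> bool" where
  "conn L i j \<longleftrightarrow> j \<le> i \<and> i \<le> j + L"

definition valid_assoc :: "nat \<Rightarrow> nat \<Rightarrow> (nat \<Rightarrow> nat set) \<Rightarrow> bool" where
  "valid_assoc K Nc C \<longleftrightarrow> (\<forall>i\<in>{1..K}. C i \<subseteq> {1..K} \<and> card (C i) \<le> Nc)"

text \<open>Zero-forcing (message passing decoding) scheme: A is the set of active MTs
  (inactive MTs are silent), dec j is the base station at which message W_j is decoded
  (so (MT j, BS dec j) is a decoding pair), and ord is a decoding order (time step).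
  Each message is decoded at exactly one BS, each BS decodes at most one message.
  At BS dec j, every other active message W_k interfering there must have been decoded
  earlier at another BS and passed to BS dec j, i.e. dec j \<in> C k.\<close>

definition zf_scheme ::
  "nat \<Rightarrow> nat \<Rightarrow> (nat \<Rightarrow> nat set) \<Rightarrow> nat set \<Rightarrow> (nat \<Rightarrow> nat) \<Rightarrow> (nat \<Rightarrow> nat) \<Rightarrow> bool" where
  "zf_scheme K L C A dec ord \<longleftrightarrow>
     A \<subseteq> {1..K} \<and> inj_on dec A \<and>
     (\<forall>j\<in>A. dec j \<in> {1..K} \<and> dec j \<in> C j \<and> conn L j (dec j) \<and>
        (\<forall>k\<in>A. k \<noteq> j \<and> conn L k (dec j) \<longrightarrow> dec j \<in> C k \<and> ord k < ord j))"

text \<open>Maximum uplink sum DoF: each decoded message contributes one DoF.\<close>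

definition eta_zf :: "nat \<Rightarrow> nat \<Rightarrow> nat \<Rightarrow> nat" where
  "eta_zf K L Nc = Max {card A | A C dec ord. valid_assoc K Nc C \<and> zf_scheme K L C A dec ord}"

end

theory Submission
  imports Defs
begin

text \<open>
  Upper bound. List the active terminals as \<open>a 0 < a 1 < \<dots>\<close> and put \<open>d i = dec (a i)\<close>. The decoding
  order forces \<open>d\<close> to be increasing and, for every \<open>m\<close>, \<open>a m < d (m + 1)\<close> (type X) or
  \<open>d m + L < a (m + 1)\<close> (type Y): otherwise each of the messages \<open>a m\<close>, \<open>a (m + 1)\<close> would have to be
  decoded before the other. As \<open>a m\<close> may be seen by at most \<open>N\<close> of the base stations \<open>d i\<close>, type X
  gives \<open>d (m + 1) \<ge> d (m - N) + L + 2\<close>, type Y gives \<open>d (m + N + 1) \<ge> d m + L + 2\<close>, and in any case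
  \<open>d (s + N + 1) \<ge> d s + L + 2\<close> for some \<open>s\<close> with \<open>m - N \<le> s < m\<close>. Where type Y is followed by type X
  even \<open>d (m + 1) \<ge> d (m - 1) + L + 2\<close>. Suppose \<open>c > 1\<close>, \<open>c (N + 1) \<le> L + 2\<close> and
  \<open>2 N c \<le> L + 2 N\<close>. Measured by the deficit \<open>(c v - d v) / (c - 1)\<close>, a unit step costs at most 1, a
  jump by \<open>N + 1\<close> is free, and a change from Y to X earns \<open>2 (N - 1)\<close>. This suffices to keep the
  deficit bounded, so at most \<open>K / c + O(1)\<close> terminals are active. For \<open>N \<le> L\<close> the largest
  admissible \<open>c\<close> is the reciprocal of the claimed value.

  Lower bound. For \<open>N \<le> L\<close> use blocks of length \<open>L + 2\<close> with active residues \<open>0, \<dots>, N\<close>, decoded at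
  the base stations with residues \<open>1, \<dots>, N + 1\<close> in descending order; or blocks of length \<open>2 N + L\<close>
  with active residues \<open>0, \<dots>, N - 1\<close> and \<open>N + L, \<dots>, 2 N + L - 1\<close>, decoded at the base stations with
  residues \<open>0, \<dots>, 2 N - 1\<close>, where the two halves do not interfere with each other.
\<close>

section \<open>Boundedness of the deficit\<close>

text \<open>The invariant at position \<open>t\<close>: during an X-run, of any two positions in the window
  \<open>{t - N..t}\<close> one has deficit at most \<open>N - 1\<close> (\<open>Full\<close>), or the last change from Y to X is so recent that
  the window is not yet filled (\<open>Early\<close>); during a Y-run, at least one recent position with a jump of
  length \<open>N + 1\<close> has deficit at most \<open>N - 1\<close> (\<open>Late\<close>). A change from X to Y preserves the deficits of
  \<open>t\<close> and \<open>s\<close> only, which is why the pairwise form of \<open>Full\<close> is needed.\<close>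

lemma potential_bound:
  fixes f :: "nat \<Rightarrow> real" and N M :: nat and X Y :: "nat \<Rightarrow> bool"
  assumes N: "N \<ge> 1"
    and init: "\<And>v. v \<le> N \<Longrightarrow> f v \<le> 0"
    and step: "\<And>v. v + 1 < M \<Longrightarrow> f (v + 1) \<le> f v + 1"
    and cut: "\<And>m. N \<le> m \<Longrightarrow> m + N + 1 < M \<Longrightarrow> X m \<or> Y m"
    and jumpX: "\<And>m. N \<le> m \<Longrightarrow> m + N + 1 < M \<Longrightarrow> X m \<Longrightarrow> f (m + 1) \<le> f (m - N)"
    and jumpY: "\<And>m. N \<le> m \<Longrightarrow> m + N + 1 < M \<Longrightarrow> Y m \<Longrightarrow> f (m + N + 1) \<le> f m"
    and jump: "\<And>m. N \<le> m \<Longrightarrow> m + N + 1 < M \<Longrightarrow>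
                 \<exists>s. m \<le> s + N \<and> s < m \<and> f (s + N + 1) \<le> f s"
    and jumpYX: "\<And>m. N < m \<Longrightarrow> m + N + 1 < M \<Longrightarrow> Y (m - 1) \<Longrightarrow> X m \<Longrightarrow>
                   f (m + 1) \<le> f (m - 1) - (2 * real N - 2)"
    and M: "2 * N + 1 < M"
  shows "f (M - 1) \<le> 3 * real N"
proof -
  define B where "B = real N - 1"
  have walk: "f (v + k) \<le> f v + real k" if "v + k < M" for v k
    using that
  proof (induction k)
    case (Suc k)
    then have "f (v + k + 1) \<le> f (v + k) + 1" by (intro step) auto
    with Suc show ?case by auto
  qed auto
  define Full where "Full t \<longleftrightarrow> (\<forall>u v. t \<le> u + N \<and> u < v \<and> v \<le> t \<longrightarrow> f u \<le> B \<or> f v \<le> B)" for t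
  define Early where "Early t \<longleftrightarrow> (\<exists>n. n < t \<and> t < n + N \<and>
     (f (n + 1) \<le> 0 \<or> f n \<le> B \<and> f (n + 1) \<le> 1))" for t
  define Late where "Late t \<longleftrightarrow> (\<exists>v. v < t \<and> t \<le> v + N + 1 \<and> f v \<le> B \<and> f (v + N + 1) \<le> f v)" for t
  \<comment> \<open>From deficit 0 at \<open>n + 1\<close>, the unit steps up to
    \<open>n + N\<close> stay within \<open>B\<close>; from deficit 1, only the last one can exceed
    \<open>B\<close>.\<close>
  have full: "Full (n + N)"
    if h: "f (n + 1) \<le> 0 \<or> f n \<le> B \<and> f (n + 1) \<le> 1" and lt: "n + N < M" for n
    unfolding Full_def
  proof (intro allI impI)
    fix u v assume uv: "n + N \<le> u + N \<and> u < v \<and> v \<le> n + N"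
    have w: "f i \<le> f (n + 1) + (real i - real n - 1)" if "n < i" "i \<le> n + N" for i
      using walk[of "n + 1" "i - (n + 1)"] that lt by (auto simp: of_nat_diff)
    show "f u \<le> B \<or> f v \<le> B"
    proof (cases "f (n + 1) \<le> 0")
      case True
      then show ?thesis using w[of v] uv unfolding B_def by linarith
    next
      case False
      show ?thesis
      proof (cases "u = n")
        case True then show ?thesis using h False by auto
      next
        case False': False
        then show ?thesis using w[of u] uv h False unfolding B_def by linarith
      qed
    qed
  qed
  have early_or_full: "Full (n + 1) \<or> Early (n + 1)"
    if h: "f (n + 1) \<le> 0 \<or> f n \<le> B \<and> f (n + 1) \<le> 1" and lt: "n + N < M" for n
  proof (cases "N = 1")
    case True then show ?thesis using full[OF h lt] by simp
  next
    case False
    then have "n < n + 1 \<and> n + 1 < n + N" using N by simp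
    then show ?thesis using h unfolding Early_def by blast
  qed
  have inv: "Full t \<or> Early t \<or> Late t \<and> N < t \<and> Y (t - 1)" if "N \<le> t" "t + N + 1 \<le> M" for t
    using that
  proof (induction t rule: dec_induct)
    case base
    have "Full N" using init N unfolding Full_def B_def by (force simp: le_diff_eq)
    then show ?case ..
  next
    case (step t)
    then have IH: "Full t \<or> Early t \<or> Late t \<and> N < t \<and> Y (t - 1)"
      and tN: "N \<le> t" and tM: "t + N + 1 < M" by auto
    from IH consider "Full t" | "Early t" | "Late t" "N < t" "Y (t - 1)" by blast
    then show ?case
    proof cases
      case 1
      show ?thesis
      proof (cases "X t")
        case True
        have "Full (t + 1)"
          unfolding Full_def
        proof (intro allI impI)
          fix u v assume uv: "t + 1 \<le> u + N \<and> u < v \<and> v \<le> t + 1"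
          show "f u \<le> B \<or> f v \<le> B"
          proof (cases "v = t + 1")
            case v: True
            \<comment> \<open>Position \<open>t + 1\<close> inherits the deficit bound of
              \<open>t - N\<close>, which leaves the window.\<close>
            have "f (t - N) \<le> B \<or> f u \<le> B"
              using 1[unfolded Full_def, rule_format, of "t - N" u] uv v tN by auto
            then show ?thesis using jumpX[OF tN tM True] v by auto
          next
            case False
            then show ?thesis using 1 uv unfolding Full_def by auto
          qed
        qed
        then show ?thesis by simp
      next
        case False
        then have Y: "Y t" using cut[OF tN tM] by blast
        obtain s where s: "t \<le> s + N" "s < t" "f (s + N + 1) \<le> f s"
          using jump[OF tN tM] by blast
        \<comment> \<open>Both \<open>s\<close> and \<open>t\<close> start a free jump of length
          \<open>N + 1\<close>, so either can witness \<open>Late\<close>.\<close>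
        have "f s \<le> B \<or> f t \<le> B" using 1 s unfolding Full_def by auto
        then have "Late (t + 1)"
        proof
          assume "f s \<le> B"
          then show ?thesis unfolding Late_def using s by (intro exI[of _ s]) auto
        next
          assume "f t \<le> B"
          then show ?thesis unfolding Late_def using jumpY[OF tN tM Y] by (intro exI[of _ t]) auto
        qed
        then show ?thesis using Y tN by simp
      qed
    next
      case 2
      then obtain n where n: "n < t" "t < n + N" "f (n + 1) \<le> 0 \<or> f n \<le> B \<and> f (n + 1) \<le> 1"
        unfolding Early_def by blast
      show ?thesis
      proof (cases "X t")
        case True
        show ?thesis
        proof (cases "t + 1 = n + N")
          case True
          then show ?thesis using full[OF n(3)] tM by simp
        next
          case False
          then have "n < t + 1 \<and> t + 1 < n + N" using n by simp
          then have "Early (t + 1)" using n(3) unfolding Early_def by blast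
          then show ?thesis by simp
        qed
      next
        case False
        then have Y: "Y t" using cut[OF tN tM] by blast
        have "f t \<le> f (n + 1) + (real t - real n - 1)"
          using walk[of "n + 1" "t - (n + 1)"] n tM by (auto simp: of_nat_diff)
        moreover have "real t + 1 \<le> real n + real N" using n by linarith
        ultimately have "f t \<le> B" using n(3) unfolding B_def by linarith
        then have "Late (t + 1)"
          unfolding Late_def using jumpY[OF tN tM Y] by (intro exI[of _ t]) auto
        then show ?thesis using Y tN by simp
      qed
    next
      case 3
      then obtain v where v: "v < t" "t \<le> v + N + 1" "f v \<le> B" "f (v + N + 1) \<le> f v"
        unfolding Late_def by blast
      show ?thesis
      proof (cases "Y t")
        case Y: True
        have "Late (t + 1)"
        proof (cases "t = v + N + 1")
          case True
          then have "f t \<le> B" using v by simp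
          then show ?thesis
            unfolding Late_def using jumpY[OF tN tM Y] by (intro exI[of _ t]) auto
        next
          case False
          then show ?thesis unfolding Late_def using v by (intro exI[of _ v]) auto
        qed
        then show ?thesis using Y tN by simp
      next
        case False
        then have X: "X t" using cut[OF tN tM] by blast
        have J: "f (t + 1) \<le> f (t - 1) - (2 * real N - 2)"
          by (rule jumpYX[OF 3(2) tM 3(3) X])
        have W: "f (t - 1) \<le> f v + (real t - 1 - real v)"
        proof -
          have "t - 1 < M" using tM by simp
          then show ?thesis using walk[of v "t - 1 - v"] v by (auto simp: of_nat_diff)
        qed
        \<comment> \<open>The gain \<open>2 * B\<close> offsets deficit \<open>B\<close> at
          \<open>v\<close> plus \<open>N - 1\<close> unit steps. For \<open>t = v + N + 1\<close>
          one step remains, but then the jump from \<open>v\<close> gives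
          \<open>f t \<le> B\<close>.\<close>
        have "f (t + 1) \<le> 0 \<or> f t \<le> B \<and> f (t + 1) \<le> 1"
        proof (cases "t = v + N + 1")
          case True
          then show ?thesis using v J W unfolding B_def by auto
        next
          case False
          then have "real t \<le> real v + real N" using v by linarith
          then show ?thesis using v J W unfolding B_def by linarith
        qed
        then show ?thesis using early_or_full[of t] tM by auto
      qed
    qed
  qed
  \<comment> \<open>The last position covered by \<open>inv\<close>. Some \<open>v\<close> at most
    \<open>2 * N + 1\<close> steps before \<open>M - 1\<close> has deficit at most
    \<open>N - 1\<close>, whence \<open>3 * N\<close>.\<close>
  define t where "t = M - N - 1"
  have t: "N \<le> t" "t + N + 1 = M" using M by (auto simp: t_def)
  have "\<exists>v. v \<le> t \<and> t \<le> v + N + 1 \<and> f v \<le> B"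
  proof -
    consider "Full t" | "Early t" | "Late t" using inv[of t] t by auto
    then show ?thesis
    proof cases
      case 1
      then have "f (t - 1) \<le> B \<or> f t \<le> B" using N t unfolding Full_def by auto
      then show ?thesis
      proof
        assume "f (t - 1) \<le> B"
        then show ?thesis by (intro exI[of _ "t - 1"]) auto
      next
        assume "f t \<le> B"
        then show ?thesis by (intro exI[of _ t]) auto
      qed
    next
      case 2
      then obtain n where n: "n < t" "t < n + N" "f (n + 1) \<le> 0 \<or> f n \<le> B \<and> f (n + 1) \<le> 1"
        unfolding Early_def by blast
      have "real N \<ge> 2" using n by linarith
      then have "f (n + 1) \<le> B" using n unfolding B_def by linarith
      then show ?thesis using n by (intro exI[of _ "n + 1"]) auto
    next
      case 3
      then show ?thesis unfolding Late_def using less_imp_le by blast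
    qed
  qed
  then obtain v where v: "v \<le> t" "t \<le> v + N + 1" "f v \<le> B" by blast
  have "f (M - 1) \<le> f v + (real M - 1 - real v)"
    using walk[of v "M - 1 - v"] v t by (auto simp: of_nat_diff)
  moreover have "real M \<le> real v + 2 * real N + 2" using v t by linarith
  ultimately show ?thesis using v unfolding B_def by linarith
qed

section \<open>Spacing of the decoding base stations\<close>

locale sorted_scheme =
  fixes a d :: "nat \<Rightarrow> nat" and L N M :: nat
  assumes a_less: "\<And>i j. i < j \<Longrightarrow> j < M \<Longrightarrow> a i < a j"
    and d_less: "\<And>i j. i < j \<Longrightarrow> j < M \<Longrightarrow> d i < d j"
    and conn_pair: "\<And>i. i < M \<Longrightarrow> d i \<le> a i \<and> a i \<le> d i + L"
    and card_conn: "\<And>m I. m < M \<Longrightarrow> I \<subseteq> {..<M} \<Longrightarrow> (\<And>i. i \<in> I \<Longrightarrow> d i \<le> a m \<and> a m \<le> d i + L)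
                      \<Longrightarrow> card I \<le> N"
    and acyclic_pair: "\<And>m. m + 1 < M \<Longrightarrow> a m < d (m + 1) \<or> d m + L < a (m + 1)"
begin

lemma d_mono: "i \<le> j \<Longrightarrow> j < M \<Longrightarrow> d i \<le> d j"
  using d_less[of i j] by (cases "i = j") auto

text \<open>Otherwise all \<open>N + 1\<close> base stations \<open>d i, ..., d (i + N)\<close>
  would hear \<open>a m\<close>.\<close>

lemma window:
  assumes "m < M" "i + N < M" "a m \<le> d i + L"
  shows "a m < d (i + N)"
proof (rule ccontr)
  assume "\<not> a m < d (i + N)"
  then have "card {i..i + N} \<le> N"
    using assms by (intro card_conn[of m])
      (auto intro: order_trans[OF d_mono] order_trans[OF assms(3)] dest: d_mono[of i])
  then show False by simp
qed

text \<open>As \<open>d m \<le> a m\<close>, \<open>window\<close> puts \<open>a m\<close> out of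
  reach of \<open>d (m - N)\<close>; the 2 comes from the strict chain
  \<open>d (m - N) + L < a m < d (m + 1)\<close>.\<close>

lemma jumpX:
  assumes "N \<le> m" "m + 1 < M" "a m < d (m + 1)"
  shows "d (m - N) + L + 2 \<le> d (m + 1)"
proof -
  have "\<not> a m \<le> d (m - N) + L"
    using window[of m "m - N"] conn_pair[of m] assms by auto
  then show ?thesis using assms by simp
qed

lemma jumpY:
  assumes "m + N + 1 < M" "d m + L < a (m + 1)"
  shows "d m + L + 2 \<le> d (m + N + 1)"
  using window[of "m + 1" "m + 1"] conn_pair[of "m + 1"] assms by (auto simp: add.commute add.left_commute)

lemma jump:
  assumes "1 \<le> N" "N \<le> m" "m + N < M"
  shows "\<exists>s. m \<le> s + N \<and> s < m \<and> d s + L + 2 \<le> d (s + N + 1)"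
proof -
  \<comment> \<open>\<open>Greatest P\<close> is the last position before \<open>m\<close> whose
    base station does not hear \<open>a m\<close>; \<open>window\<close> applies to its
    successor.\<close>
  define P where "P s \<longleftrightarrow> s < m \<and> d s + L < a m" for s
  have "P (m - N)"
    using window[of m "m - N"] conn_pair[of m] assms unfolding P_def by force
  moreover have bd: "\<And>s. P s \<Longrightarrow> s \<le> m" by (simp add: P_def)
  moreover define s where "s = Greatest P"
  ultimately have P: "P s" and ge: "m - N \<le> s" and nP: "\<not> P (s + 1)"
    using GreatestI_nat[of P "m - N" m] Greatest_le_nat[of P "m - N" m]
      Greatest_le_nat[of P "s + 1" m] by auto
  have s: "s < m" "d s + L < a m" using P by (auto simp: P_def)
  have "a m \<le> d (s + 1) + L"
    using s nP conn_pair[of m] assms unfolding P_def by (cases "s + 1 = m") auto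
  then have "a m < d (s + 1 + N)" using s assms by (intro window) auto
  then show ?thesis using s ge by (intro exI[of _ s]) (auto simp: add.commute add.left_commute)
qed

lemma length_bound:
  fixes c :: real
  assumes N: "1 \<le> N" and c: "1 < c" "c * (real N + 1) \<le> real L + 2" "2 * real N * c \<le> real L + 2 * real N"
    and K: "\<And>i. i < M \<Longrightarrow> d i \<le> K"
  shows "c * real M \<le> real K + (2 * c * (real N + 1) + 3 * real N * (c - 1))"
proof (cases "2 * N + 1 < M")
  case False
  then have "real M \<le> 2 * real N + 1" by linarith
  then have "c * real M \<le> c * (2 * real N + 1)" using c by (intro mult_left_mono) auto
  also have "\<dots> \<le> 2 * c * (real N + 1)" using c by (simp add: algebra_simps)
  finally show ?thesis using c by (simp add: add.assoc add_increasing add_increasing2)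
next
  case M: True
  \<comment> \<open>The shift by \<open>N\<close> makes the first \<open>N + 1\<close> deficits
    nonpositive, as the potential argument requires.\<close>
  define f where "f v = (c * (real v - real N) - real (d v)) / (c - 1)" for v
  have f_le: "f u \<le> f v + e"
    if "c * (real u - real v) \<le> real (d u) - real (d v) + e * (c - 1)" for u v e
  proof -
    have "f v + e = (c * (real v - real N) - real (d v) + e * (c - 1)) / (c - 1)"
      unfolding f_def using c by (simp add: add_divide_distrib)
    moreover have "f u \<le> \<dots>"
      unfolding f_def using that c by (intro divide_right_mono) (auto simp: algebra_simps)
    ultimately show ?thesis by simp
  qed
  have f_jump: "f (v + N + 1) \<le> f v" if "d v + L + 2 \<le> d (v + N + 1)" for v
  proof -
    have "real (d v) + real L + 2 \<le> real (d (v + N + 1))" using that by linarith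
    then show ?thesis using f_le[of "v + N + 1" v 0] c(2) by (simp add: add.commute)
  qed
  have "f (M - 1) \<le> 3 * real N"
  proof (rule potential_bound[where X = "\<lambda>m. a m < d (m + 1)" and Y = "\<lambda>m. d m + L < a (m + 1)"])
    show "f v \<le> 0" if "v \<le> N" for v
    proof -
      have "c * (real v - real N) \<le> 0" using that c by (intro mult_nonneg_nonpos) auto
      then show ?thesis unfolding f_def using c by (intro divide_nonpos_pos) auto
    qed
    show "f (v + 1) \<le> f v + 1" if "v + 1 < M" for v
      using f_le[of "v + 1" v 1] d_less[of v "v + 1"] that by simp
    show "f (m + 1) \<le> f (m - N)" if "N \<le> m" "m + N + 1 < M" "a m < d (m + 1)" for m
      using f_jump[of "m - N"] jumpX[of m] that by simp
    show "f (m + 1) \<le> f (m - 1) - (2 * real N - 2)"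
      if m: "N < m" "m + N + 1 < M" "d (m - 1) + L < a (m - 1 + 1)" "a m < d (m + 1)" for m
    proof -
      \<comment> \<open>Here \<open>d (m - 1) + L < a m < d (m + 1)\<close>; the third condition on
        \<open>c\<close> is exactly what makes the gain \<open>2 * N - 2\<close>.\<close>
      have "real (d (m - 1)) + real L + 2 \<le> real (d (m + 1))" using m by simp
      moreover have "c * (real (m + 1) - real (m - 1)) = 2 * c" using m by (simp add: of_nat_diff)
      ultimately have "c * (real (m + 1) - real (m - 1))
          \<le> real (d (m + 1)) - real (d (m - 1)) + (- (2 * real N - 2)) * (c - 1)"
        using c(3) by (simp add: algebra_simps)
      from f_le[OF this] show ?thesis by simp
    qed
    show "f (m + N + 1) \<le> f m" if "m + N + 1 < M" "d m + L < a (m + 1)" for m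
      using f_jump jumpY that by blast
    show "\<exists>s. m \<le> s + N \<and> s < m \<and> f (s + N + 1) \<le> f s" if "N \<le> m" "m + N + 1 < M" for m
      using f_jump jump[of m] N that by fastforce
  qed (use N M acyclic_pair in auto)
  then have "c * (real (M - 1) - real N) - real (d (M - 1)) \<le> 3 * real N * (c - 1)"
    unfolding f_def using c by (simp add: field_simps)
  moreover have "real (d (M - 1)) \<le> real K" using K[of "M - 1"] M by simp
  moreover have "real (M - 1) = real M - 1" using M by (simp add: of_nat_diff)
  moreover have "0 \<le> c * (real N + 1)" using c by simp
  ultimately show ?thesis by (simp add: algebra_simps)
qed

end

section \<open>Upper bound for arbitrary schemes\<close>

lemma zf_scheme_card_bound:
  fixes c :: real
  assumes zf: "zf_scheme K L C A dec ord" and va: "valid_assoc K N C"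
    and N: "1 \<le> N" and c: "1 < c" "c * (real N + 1) \<le> real L + 2" "2 * real N * c \<le> real L + 2 * real N"
  shows "c * real (card A) \<le> real K + (2 * c * (real N + 1) + 3 * real N * (c - 1))"
proof -
  have A: "A \<subseteq> {1..K}" and inj: "inj_on dec A"
    and dec: "\<And>j. j \<in> A \<Longrightarrow> dec j \<in> {1..K} \<and> dec j \<in> C j \<and> conn L j (dec j)"
    and intf: "\<And>j k. j \<in> A \<Longrightarrow> k \<in> A \<Longrightarrow> k \<noteq> j \<Longrightarrow> conn L k (dec j) \<Longrightarrow> dec j \<in> C k \<and> ord k < ord j"
    using zf unfolding zf_scheme_def by auto
  have finA: "finite A" using A finite_subset by blast
  \<comment> \<open>Otherwise \<open>dec k \<le> dec j \<le> j < k \<le> dec k + L\<close>, and each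
    message would have to be decoded before the other.\<close>
  have dec_less: "dec j < dec k" if "j \<in> A" "k \<in> A" "j < k" for j k
  proof (rule ccontr)
    assume "\<not> dec j < dec k"
    then have "conn L j (dec k)" "conn L k (dec j)"
      using dec[of j] dec[of k] that unfolding conn_def by auto
    then show False using intf[of j k] intf[of k j] that by auto
  qed
  define M where "M = card A"
  define a where "a i = sorted_list_of_set A ! i" for i
  define d where "d i = dec (a i)" for i
  have a_in: "a i \<in> A" if "i < M" for i
    using that finA unfolding a_def M_def by (metis nth_mem set_sorted_list_of_set sorted_list_of_set.length_sorted_key_list_of_set)
  have a_less: "a i < a j" if "i < j" "j < M" for i j
    using that finA strict_sorted_list_of_set[of A] unfolding a_def M_def
    by (simp add: sorted_wrt_iff_nth_less)
  have d_less: "d i < d j" if "i < j" "j < M" for i j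
    unfolding d_def using that by (intro dec_less a_in a_less) auto
  have pair: "d i \<le> a i \<and> a i \<le> d i + L" if "i < M" for i
    using dec[OF a_in[OF that]] unfolding d_def conn_def by auto
  interpret sorted_scheme a d L N M
  proof
    fix m I assume m: "m < M" and I: "I \<subseteq> {..<M}"
      and cn: "\<And>i. i \<in> I \<Longrightarrow> d i \<le> a m \<and> a m \<le> d i + L"
    \<comment> \<open>A station \<open>d i\<close> hearing \<open>a m\<close> either decodes it or
      has to cancel it.\<close>
    have "d ` I \<subseteq> C (a m)"
    proof
      fix x assume "x \<in> d ` I"
      then obtain i where i: "i \<in> I" "x = d i" by blast
      then show "x \<in> C (a m)"
        using intf[of "a i" "a m"] dec[of "a m"] a_in[of i] a_in[OF m] cn[of i] I
        unfolding d_def conn_def by (cases "a i = a m") auto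
    qed
    moreover have "C (a m) \<subseteq> {1..K}" "card (C (a m)) \<le> N"
      using va a_in[OF m] A unfolding valid_assoc_def by auto
    moreover have "inj_on d I"
      using I d_less by (intro linorder_inj_onI) (auto simp: subset_iff neq_iff)
    ultimately show "card I \<le> N"
      by (metis card_image card_mono finite_atLeastAtMost finite_subset le_trans)
  next
    fix m assume m: "m + 1 < M"
    show "a m < d (m + 1) \<or> d m + L < a (m + 1)"
    proof (rule ccontr)
      assume "\<not> ?thesis"
      then have "conn L (a m) (d (m + 1))" "conn L (a (m + 1)) (d m)"
        using pair[of m] pair[of "m + 1"] a_less[of m "m + 1"] m unfolding conn_def by auto
      then show False
        using intf[of "a m" "a (m + 1)"] intf[of "a (m + 1)" "a m"] a_in[of m] a_in[of "m + 1"]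
          a_less[of m "m + 1"] m unfolding d_def by auto
    qed
  qed (use a_less d_less pair in auto)
  have "d i \<le> K" if "i < M" for i using dec[OF a_in[OF that]] unfolding d_def by auto
  from length_bound[OF N c this] show ?thesis unfolding M_def .
qed

section \<open>The maximum and its simple bounds\<close>

lemma finite_zf_cards:
  "finite {card A | A C dec ord. valid_assoc K N C \<and> zf_scheme K L C A dec ord}"
proof (rule finite_subset)
  show "{card A | A C dec ord. valid_assoc K N C \<and> zf_scheme K L C A dec ord} \<subseteq> {..K}"
    unfolding zf_scheme_def using card_mono[of "{1..K}"] by fastforce
qed simp

lemma eta_zf_attained:
  obtains A C dec ord where "eta_zf K L N = card A" "valid_assoc K N C" "zf_scheme K L C A dec ord"
proof -
  let ?S = "{card A | A C dec ord. valid_assoc K N C \<and> zf_scheme K L C A dec ord}"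
  have "valid_assoc K N (\<lambda>_. {}) \<and> zf_scheme K L (\<lambda>_. {}) {} id id"
    unfolding valid_assoc_def zf_scheme_def by simp
  then have "?S \<noteq> {}" by blast
  then have "eta_zf K L N \<in> ?S" unfolding eta_zf_def using finite_zf_cards by (intro Max_in)
  then show ?thesis using that by blast
qed

text \<open>Associating \<open>k\<close> with just the decoding stations that hear it suffices for
  all cancellations, so the backhaul constraint becomes a count.\<close>

lemma eta_zf_ge:
  assumes A: "A \<subseteq> {1..K}" and inj: "inj_on dec A"
    and dec: "\<And>j. j \<in> A \<Longrightarrow> 1 \<le> dec j \<and> dec j \<le> j \<and> j \<le> dec j + L"
    and ord: "\<And>j k. j \<in> A \<Longrightarrow> k \<in> A \<Longrightarrow> k \<noteq> j \<Longrightarrow> dec j \<le> k \<Longrightarrow> k \<le> dec j + L \<Longrightarrow> ord k < (ord j :: nat)"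
    and card: "\<And>k. k \<in> A \<Longrightarrow> card {d \<in> dec ` A. d \<le> k \<and> k \<le> d + L} \<le> N"
  shows "card A \<le> eta_zf K L N"
proof -
  define C where "C k = (if k \<in> A then {d \<in> dec ` A. d \<le> k \<and> k \<le> d + L} else {})" for k
  have K: "dec j \<in> {1..K}" if "j \<in> A" for j using dec[OF that] A that by fastforce
  have "valid_assoc K N C"
    unfolding valid_assoc_def C_def using card K by auto
  moreover have "zf_scheme K L C A dec ord"
    unfolding zf_scheme_def conn_def C_def using A inj dec ord K by auto
  ultimately show ?thesis
    unfolding eta_zf_def using finite_zf_cards by (intro Max_ge) blast+
qed

lemma eta_zf_le: "eta_zf K L N \<le> K"
proof -
  obtain A C dec ord where "eta_zf K L N = card A" "zf_scheme K L C A dec ord"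
    using eta_zf_attained .
  then show ?thesis
    unfolding zf_scheme_def using card_mono[of "{1..K}" A] by simp
qed

lemma eta_zf_full:
  assumes "L + 1 \<le> N"
  shows "eta_zf K L N = K"
proof (rule antisym[OF eta_zf_le])
  have "card {1..K} \<le> eta_zf K L N"
  proof (rule eta_zf_ge[where dec = id and ord = "\<lambda>k. K - k"])
    fix k assume "k \<in> {1..K}"
    have "card {d \<in> id ` {1..K}. d \<le> k \<and> k \<le> d + L} \<le> card {k - L..k}"
      by (intro card_mono) auto
    also have "\<dots> \<le> N" using assms by simp
    finally show "card {d \<in> id ` {1..K}. d \<le> k \<and> k \<le> d + L} \<le> N" .
  qed auto
  then show "K \<le> eta_zf K L N" by simp
qed

section \<open>Block constructions\<close>

lemma block_cases:
  fixes P Q Q' :: nat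
  assumes "P dvd Q" "P dvd Q'"
  shows "Q + P \<le> Q' \<or> Q' + P \<le> Q \<or> Q = Q'"
proof -
  obtain q q' where q: "Q = P * q" "Q' = P * q'" using assms by (auto elim!: dvdE)
  consider "q + 1 \<le> q'" | "q' + 1 \<le> q" | "q = q'" by linarith
  then show ?thesis
    using q mult_le_mono2[of "q + 1" q' P] mult_le_mono2[of "q' + 1" q P] by cases auto
qed

lemma block_bounds:
  fixes q b P K :: nat
  assumes "1 \<le> q" "q \<le> b" "(b + 1) * P \<le> K"
  shows "P \<le> q * P" "q * P + P \<le> K"
proof -
  show "P \<le> q * P" using assms(1) by simp
  have "(q + 1) * P \<le> (b + 1) * P" using assms(2) by (intro mult_le_mono1) simp
  then show "q * P + P \<le> K" using assms(3) by (simp only: distrib_right mult_1)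
qed

text \<open>Blocks are numbered from 1, so that the terminals and base stations of block \<open>q\<close> are the
  numbers \<open>q * P + i\<close> with \<open>i < P\<close>, all of them positive.\<close>

lemma card_blocks:
  fixes g :: "nat \<Rightarrow> nat"
  assumes "inj_on g {..<R}" "\<And>i. i < R \<Longrightarrow> g i < P"
  shows "card {q * P + g i | q i. 1 \<le> q \<and> q \<le> b \<and> i < R} = b * R"
proof -
  have "inj_on (\<lambda>(q, i). q * P + g i) ({1..b} \<times> {..<R})"
  proof (rule inj_onI, clarsimp)
    fix q i q' i' assume h: "i < R" "i' < R" "q * P + g i = q' * P + g i'"
    have gi: "g i < P" "g i' < P" using assms(2) h by auto
    have "q * P = q' * P" using block_cases[of P "q * P" "q' * P"] h gi by auto
    then have "q = q'" using gi by simp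
    then show "q = q' \<and> i = i'" using h assms(1) by (auto dest: inj_onD)
  qed
  then have "card ((\<lambda>(q, i). q * P + g i) ` ({1..b} \<times> {..<R})) = b * R"
    by (simp add: card_image)
  moreover have "(\<lambda>(q, i). q * P + g i) ` ({1..b} \<times> {..<R})
      = {q * P + g i | q i. 1 \<le> q \<and> q \<le> b \<and> i < R}" by force
  ultimately show ?thesis by simp
qed

lemma eta_zf_blocks_descending:
  assumes N: "1 \<le> N" "N \<le> L" and K: "(b + 1) * (L + 2) \<le> K"
  shows "b * (N + 1) \<le> eta_zf K L N"
proof -
  define P where "P = L + 2"
  define A where "A = {q * P + i | q i. 1 \<le> q \<and> q \<le> b \<and> i < N + 1}"
  \<comment> \<open>Residue 0 uses the station of residue \<open>N + 1\<close> in the preceding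
    block, at distance \<open>L + 1 - N\<close>, which is at most \<open>L\<close> because
    \<open>1 \<le> N\<close>.\<close>
  define dec where "dec k = (if k mod P = 0 then k - P + N + 1 else k)" for k
  have block: "P \<le> q * P" "q * P + P \<le> K" if "1 \<le> q" "q \<le> b" for q
    using block_bounds[OF that, of P K] K by (auto simp only: P_def)
  have A_cases: thesis
    if "k \<in> A" and
      "\<And>Q i. k = Q + i \<Longrightarrow> i \<le> N \<Longrightarrow> P dvd Q \<Longrightarrow> P \<le> Q \<Longrightarrow> Q + P \<le> K \<Longrightarrow>
        dec k = (if i = 0 then Q - P + N + 1 else Q + i) \<Longrightarrow> thesis" for k thesis
  proof -
    obtain q i where k: "k = q * P + i" "1 \<le> q" "q \<le> b" "i \<le> N"
      using \<open>k \<in> A\<close> unfolding A_def by auto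
    moreover have "k mod P = i" using k N by (simp add: P_def del: mult_Suc_right add_2_eq_Suc')
    ultimately show thesis using that(2)[of "q * P" i] block[of q] by (simp add: dec_def)
  qed
  have "card A \<le> eta_zf K L N"
  proof (rule eta_zf_ge[where dec = dec and ord = "\<lambda>k. K - k"])
    show "A \<subseteq> {1..K}"
    proof
      fix k assume "k \<in> A"
      then show "k \<in> {1..K}" by (rule A_cases) (use N in \<open>auto simp: P_def\<close>)
    qed
    show "inj_on dec A"
    proof (rule inj_onI)
      fix j k assume j: "j \<in> A" and k: "k \<in> A" and eq: "dec j = dec k"
      show "j = k"
      proof (rule A_cases[OF j], rule A_cases[OF k])
        fix Q i Q' i'
        assume h: "P dvd Q" "j = Q + i" "i \<le> N" "P \<le> Q"
          "dec j = (if i = 0 then Q - P + N + 1 else Q + i)"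
          "P dvd Q'" "k = Q' + i'" "i' \<le> N" "P \<le> Q'"
          "dec k = (if i' = 0 then Q' - P + N + 1 else Q' + i')"
        have "N + 1 < P" using N P_def by simp
        then show "j = k"
          using block_cases[of P Q Q'] eq h by (auto split: if_splits)
      qed
    qed
    show "1 \<le> dec j \<and> dec j \<le> j \<and> j \<le> dec j + L" if "j \<in> A" for j
      using that by (rule A_cases) (use N in \<open>auto simp: P_def\<close>)
    show "K - k < K - j"
      if j: "j \<in> A" and k: "k \<in> A" and kj: "k \<noteq> j" "dec j \<le> k" "k \<le> dec j + L" for j k
    proof (rule A_cases[OF j], rule A_cases[OF k])
      fix Q i Q' i'
      assume h: "P dvd Q" "j = Q + i" "i \<le> N" "P \<le> Q"
        "dec j = (if i = 0 then Q - P + N + 1 else Q + i)"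
        "P dvd Q'" "k = Q' + i'" "i' \<le> N" "P \<le> Q'" "Q' + P \<le> K"
      have P: "N + 1 < P" using N P_def by simp
      \<comment> \<open>No active terminal lies strictly between \<open>dec j\<close> and
        \<open>j\<close>, so all interferers come later.\<close>
      have "j < k"
        using block_cases[of P Q Q'] kj h P by (auto split: if_splits)
      then show "K - k < K - j" using h P by auto
    qed
    show "card {d \<in> dec ` A. d \<le> k \<and> k \<le> d + L} \<le> N" if k: "k \<in> A" for k
    proof (rule A_cases[OF k])
      fix Q i assume h: "P dvd Q" "k = Q + i" "i \<le> N" "P \<le> Q"
      define S where "S = Q - P"
      have S: "Q = S + P" using h by (simp add: S_def)
      \<comment> \<open>At most \<open>N - i\<close> stations of the preceding block and
        \<open>i\<close> of its own block hear \<open>k\<close>.\<close>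
      have "{d \<in> dec ` A. d \<le> k \<and> k \<le> d + L} \<subseteq> {S + i + 2..S + N + 1} \<union> {Q + 1..Q + i}"
      proof
        fix d assume "d \<in> {d \<in> dec ` A. d \<le> k \<and> k \<le> d + L}"
        then obtain j where j: "j \<in> A" and d: "d = dec j" "d \<le> k" "k \<le> d + L" by auto
        show "d \<in> {S + i + 2..S + N + 1} \<union> {Q + 1..Q + i}"
        proof (rule A_cases[OF j])
          fix Q' i' assume h': "P dvd Q'" "i' \<le> N" "P \<le> Q'"
            "dec j = (if i' = 0 then Q' - P + N + 1 else Q' + i')"
          have P: "P = L + 2" by (simp add: P_def)
          show ?thesis
            using block_cases[of P Q Q'] h h' d N S P by (auto split: if_splits)
        qed
      qed
      then have "card {d \<in> dec ` A. d \<le> k \<and> k \<le> d + L}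
          \<le> card ({S + i + 2..S + N + 1} \<union> {Q + 1..Q + i})"
        by (intro card_mono) auto
      also have "\<dots> \<le> card {S + i + 2..S + N + 1} + card {Q + 1..Q + i}"
        by (rule card_Un_le)
      also have "\<dots> \<le> N" using h by simp
      finally show ?thesis .
    qed
  qed
  moreover have "card A = b * (N + 1)"
    unfolding A_def by (rule card_blocks[where g = "\<lambda>i. i"]) (use N in \<open>auto simp: P_def\<close>)
  ultimately show ?thesis by simp
qed

lemma eta_zf_blocks_two_sided:
  assumes K: "(b + 1) * (2 * N + L) \<le> K"
  shows "b * (2 * N) \<le> eta_zf K L N"
proof (cases "N = 0")
  case False
  define P where "P = 2 * N + L"
  define g where "g i = (if i < N then i else i + L)" for i
  define A where "A = {q * P + g i | q i. 1 \<le> q \<and> q \<le> b \<and> i < 2 * N}"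
  define dec where "dec k = (if k mod P < N then k else k - L)" for k
  \<comment> \<open>Descending in the lower half, ascending in the upper; the values are never
    compared across halves, which do not interfere.\<close>
  define ord where "ord k = (if k mod P < N then K - k else k)" for k
  have block: "P \<le> q * P" "q * P + P \<le> K" if "1 \<le> q" "q \<le> b" for q
    using block_bounds[OF that, of P K] K by (auto simp only: P_def)
  have A_cases: thesis
    if "k \<in> A" and
      "\<And>Q i. k = Q + (if i < N then i else i + L) \<Longrightarrow> i < 2 * N \<Longrightarrow> P dvd Q \<Longrightarrow> P \<le> Q \<Longrightarrow> Q + P \<le> K \<Longrightarrow>
        dec k = Q + i \<Longrightarrow> ord k = (if i < N then K - k else k) \<Longrightarrow> thesis" for k thesis
  proof -
    obtain q i where k: "k = q * P + g i" "1 \<le> q" "q \<le> b" "i < 2 * N"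
      using \<open>k \<in> A\<close> unfolding A_def by auto
    moreover have "k mod P = g i" using k by (simp add: P_def g_def)
    ultimately show thesis
      using that(2)[of "q * P" i] block[of q] by (auto simp: dec_def ord_def g_def split: if_splits)
  qed
  have P: "P = 2 * N + L" by (simp add: P_def)
  have "card A \<le> eta_zf K L N"
  proof (rule eta_zf_ge[where dec = dec and ord = ord])
    show "A \<subseteq> {1..K}"
    proof
      fix k assume "k \<in> A"
      then show "k \<in> {1..K}" by (rule A_cases) (use False P in auto)
    qed
    show "inj_on dec A"
    proof (rule inj_onI)
      fix j k assume j: "j \<in> A" and k: "k \<in> A" and eq: "dec j = dec k"
      show "j = k"
      proof (rule A_cases[OF j], rule A_cases[OF k])
        fix Q i Q' i'
        assume h: "P dvd Q" "j = Q + (if i < N then i else i + L)" "i < 2 * N" "dec j = Q + i"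
          "P dvd Q'" "k = Q' + (if i' < N then i' else i' + L)" "i' < 2 * N" "dec k = Q' + i'"
        then show "j = k"
          using block_cases[of P Q Q'] eq P by auto
      qed
    qed
    show "1 \<le> dec j \<and> dec j \<le> j \<and> j \<le> dec j + L" if "j \<in> A" for j
      using that by (rule A_cases) (use False P in auto)
    show "ord k < ord j"
      if j: "j \<in> A" and k: "k \<in> A" and kj: "k \<noteq> j" "dec j \<le> k" "k \<le> dec j + L" for j k
    proof (rule A_cases[OF j], rule A_cases[OF k])
      fix Q i Q' i'
      assume h: "P dvd Q" "j = Q + (if i < N then i else i + L)" "i < 2 * N" "dec j = Q + i"
        "ord j = (if i < N then K - j else j)" "Q' + P \<le> K"
        "P dvd Q'" "k = Q' + (if i' < N then i' else i' + L)" "i' < 2 * N"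
        "ord k = (if i' < N then K - k else k)"
      then show "ord k < ord j"
        using block_cases[of P Q Q'] kj P by (auto split: if_splits)
    qed
    show "card {d \<in> dec ` A. d \<le> k \<and> k \<le> d + L} \<le> N" if k: "k \<in> A" for k
    proof (rule A_cases[OF k])
      fix Q i assume h: "P dvd Q" "k = Q + (if i < N then i else i + L)" "i < 2 * N"
      \<comment> \<open>\<open>W\<close> has \<open>i + 1\<close> or \<open>2 * N - i\<close>
        elements, at most \<open>N\<close> in either half.\<close>
      define W where "W = (if i < N then {Q..Q + i} else {Q + i..<Q + 2 * N})"
      have "{d \<in> dec ` A. d \<le> k \<and> k \<le> d + L} \<subseteq> W"
      proof
        fix d assume "d \<in> {d \<in> dec ` A. d \<le> k \<and> k \<le> d + L}"
        then obtain j where j: "j \<in> A" and d: "d = dec j" "d \<le> k" "k \<le> d + L" by auto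
        show "d \<in> W"
        proof (rule A_cases[OF j])
          fix Q' i' assume h': "P dvd Q'" "i' < 2 * N" "dec j = Q' + i'"
          show ?thesis
            unfolding W_def
            using block_cases[of P Q Q'] h h' d P by (auto split: if_splits)
        qed
      qed
      then have "card {d \<in> dec ` A. d \<le> k \<and> k \<le> d + L} \<le> card W"
        by (intro card_mono) (auto simp: W_def)
      also have "\<dots> \<le> N" using h by (auto simp: W_def)
      finally show ?thesis .
    qed
  qed
  moreover have "card A = b * (2 * N)"
    unfolding A_def by (rule card_blocks) (auto simp: P_def g_def inj_on_def split: if_splits)
  ultimately show ?thesis by simp
qed simp

section \<open>Passage to the limit\<close>

text \<open>One \<open>R\<close> is lost to rounding, another because blocks are numbered from
  1.\<close>

lemma block_count_lower:
  fixes e :: nat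
  assumes P: "0 < P" and e: "\<And>b. (b + 1) * P \<le> K \<Longrightarrow> b * R \<le> e"
  shows "real R / real P * real K - 2 * real R \<le> real e"
proof -
  have "K < (K div P + 1) * P" using P by (metis Suc_eq_plus1 dividend_less_div_times mult_Suc)
  then have "real K < real ((K div P + 1) * P)" by (simp only: of_nat_less_iff)
  then have "real K / real P < real (K div P) + 1" using P by (simp add: field_simps)
  then have "real R * (real K / real P) \<le> real R * (real (K div P) + 1)"
    by (intro mult_left_mono) auto
  also have "\<dots> \<le> real e + 2 * real R"
  proof (cases "K div P")
    case (Suc b)
    then have "(b + 1) * P \<le> K" by (metis Suc_eq_plus1 div_times_less_eq_dividend)
    then have "real (b * R) \<le> real e" using e by (simp only: of_nat_le_iff)
    then show ?thesis using Suc by (simp add: algebra_simps)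
  qed simp
  finally show ?thesis by simp
qed

lemma tendsto_ratio_of_bounded_error:
  fixes e :: "nat \<Rightarrow> real"
  assumes "\<And>K. \<tau> * real K - c \<le> e K" "\<And>K. e K \<le> \<tau> * real K + c'"
  shows "(\<lambda>K. e K / real K) \<longlonglongrightarrow> \<tau>"
proof (rule tendsto_sandwich)
  show "(\<lambda>K. \<tau> - c / real K) \<longlonglongrightarrow> \<tau>" "(\<lambda>K. \<tau> + c' / real K) \<longlonglongrightarrow> \<tau>"
    using tendsto_diff[OF tendsto_const lim_const_over_n[of c]]
      tendsto_add[OF tendsto_const lim_const_over_n[of c']] by simp_all
  show "\<forall>\<^sub>F K in sequentially. \<tau> - c / real K \<le> e K / real K"
    using eventually_gt_at_top[of 0]
  proof eventually_elim
    case (elim K)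
    have "(\<tau> * real K - c) / real K \<le> e K / real K" by (intro divide_right_mono assms) simp
    then show ?case using elim by (simp add: diff_divide_distrib)
  qed
  show "\<forall>\<^sub>F K in sequentially. e K / real K \<le> \<tau> + c' / real K"
    using eventually_gt_at_top[of 0]
  proof eventually_elim
    case (elim K)
    have "e K / real K \<le> (\<tau> * real K + c') / real K" by (intro divide_right_mono assms) simp
    then show ?case using elim by (simp add: add_divide_distrib)
  qed
qed

text \<open>A block scheme of density \<open>R / P\<close> is optimal once \<open>c = P / R\<close>
  is admissible in the upper bound; \<open>PR\<close> states this without denominators.\<close>

lemma eta_zf_ratio_tendsto:
  fixes L N P R :: nat
  assumes N: "1 \<le> N" and RP: "0 < R" "R < P"
    and PR: "P * (N + 1) \<le> (L + 2) * R" "2 * N * P \<le> (L + 2 * N) * R"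
    and lower: "\<And>K b. (b + 1) * P \<le> K \<Longrightarrow> b * R \<le> eta_zf K L N"
  shows "(\<lambda>K. real (eta_zf K L N) / real K) \<longlonglongrightarrow> real R / real P"
proof -
  define c where "c = real P / real R"
  have "real (P * (N + 1)) \<le> real ((L + 2) * R)" "real (2 * N * P) \<le> real ((L + 2 * N) * R)"
    using PR by (simp_all only: of_nat_le_iff)
  then have c: "1 < c" "c * (real N + 1) \<le> real L + 2" "2 * real N * c \<le> real L + 2 * real N"
    using RP unfolding c_def by (simp_all add: field_simps)
  define C where "C = 2 * c * (real N + 1) + 3 * real N * (c - 1)"
  show ?thesis
  proof (rule tendsto_ratio_of_bounded_error)
    show "real R / real P * real K - 2 * real R \<le> real (eta_zf K L N)" for K
      using RP lower by (intro block_count_lower) auto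
    show "real (eta_zf K L N) \<le> real R / real P * real K + C / c" for K
    proof -
      obtain A C' dec ord where
        A: "eta_zf K L N = card A" "valid_assoc K N C'" "zf_scheme K L C' A dec ord"
        using eta_zf_attained .
      have "c * real (eta_zf K L N) \<le> real K + C"
        unfolding A(1) C_def by (rule zf_scheme_card_bound[OF A(3,2) N c])
      then have "real (eta_zf K L N) \<le> (real K + C) / c"
        using c by (simp add: field_simps)
      also have "\<dots> = real R / real P * real K + C / c"
        unfolding add_divide_distrib by (simp add: c_def)
      finally show ?thesis .
    qed
  qed
qed

theorem theorem1:
  fixes L Nc :: nat
  assumes "L \<ge> 1" and "Nc \<ge> 1"
  shows "(\<lambda>K. real (eta_zf K L Nc) / real K) \<longlonglongrightarrow>
           (if L + 1 \<le> Nc then 1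
            else if L \<le> 2 * Nc then (real Nc + 1) / (real L + 2)
            else 2 * real Nc / (2 * real Nc + real L))"
proof -
  consider "L + 1 \<le> Nc" | "Nc \<le> L" "L \<le> 2 * Nc" | "2 * Nc < L" by linarith
  then show ?thesis
  proof cases
    case 1
    have "(\<lambda>K. real (eta_zf K L Nc) / real K) \<longlonglongrightarrow> 1"
      by (rule tendsto_ratio_of_bounded_error[where c = 0 and c' = 0])
        (simp_all add: eta_zf_full[OF 1])
    then show ?thesis using 1 by simp
  next
    case 2
    \<comment> \<open>This product is the slack in the second condition on \<open>P\<close> and
      \<open>R\<close>; the first holds with equality.\<close>
    have "0 \<le> (int Nc - 1) * (2 * int Nc - int L)" using 2 assms by simp
    then have "int (2 * Nc * (L + 2)) \<le> int ((L + 2 * Nc) * (Nc + 1))"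
      by (simp add: algebra_simps)
    then have "2 * Nc * (L + 2) \<le> (L + 2 * Nc) * (Nc + 1)" by (simp only: of_nat_le_iff)
    then have "(\<lambda>K. real (eta_zf K L Nc) / real K) \<longlonglongrightarrow> real (Nc + 1) / real (L + 2)"
      using 2 assms eta_zf_blocks_descending by (intro eta_zf_ratio_tendsto) auto
    then show ?thesis using 2 by (simp add: add.commute)
  next
    case 3
    \<comment> \<open>Now the second condition is tight and the product is the slack in the
      first.\<close>
    have "0 \<le> (int Nc - 1) * (int L - 2 * int Nc)" using 3 assms by simp
    then have "int ((2 * Nc + L) * (Nc + 1)) \<le> int ((L + 2) * (2 * Nc))"
      by (simp add: algebra_simps)
    then have "(2 * Nc + L) * (Nc + 1) \<le> (L + 2) * (2 * Nc)" by (simp only: of_nat_le_iff)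
    then have "(\<lambda>K. real (eta_zf K L Nc) / real K) \<longlonglongrightarrow> real (2 * Nc) / real (2 * Nc + L)"
      using 3 assms eta_zf_blocks_two_sided by (intro eta_zf_ratio_tendsto) auto
    then show ?thesis using 3 by simp
  qed
qed

end
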